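(* There is an $\mathcal{R}$-submodule $U$ of the degree-zero component $\mathcal{M}_I(\mathcal{R})_{\mathbf{0}}$ such that \[ \mathcal{M}_I(\mathcal{R})=U+\sum_{[g]\in\Sigma/\sim}\mathfrak{I}_{[g]}, \] where each $\mathfrak{I}_{[g]}=\mathfrak{I}_{\mathbf{0},[g]}\oplus V_{[g]}$ is a graded ideal of $(\mathcal{M}_I(\mathcal{R}),\star,\psi,\phi)$.
   Context: $\mathbb{N}$ is the set of non-negative integers. For subsets $X,Y$ of an algebra with product $\star$, $X\star Y$ denotes the submodule spanned by all $x\star y$, $x\in X$, $y\in Y$. Setting. Let $\mathcal{R}$ be a commutative ring, $I$ an arbitrary index set, and $\mathcal{M}_I(\mathcal{R})$ the $\mathcal{R}$-algebra of $I\times I$ matrices over $\mathcal{R}$ with only finitely many non-zero entries, with the usual product (juxtaposition). Let $\psi,\phi$ be two commuting $\mathcal{R}$-algebra automorphisms of it and put $x\star y:=\psi(x)\phi(y)$. Let $(G,+)$ be an abelian group with neutral element $\mathbf{0}$ and let $\alpha,\beta$ be two commuting automorphisms of $G$. Suppose $\mathcal{M}_I(\mathcal{R})=\bigoplus_{g\in G}\mathcal{M}_I(\mathcal{R})_g$ is a direct sum of $\mathcal{R}$-submodules such that, for all $g,g'\in G$, $\psi(\mathcal{M}_I(\mathcal{R})_g)\subseteq\mathcal{M}_I(\mathcal{R})_{\alpha(g)}$, $\phi(\mathcal{M}_I(\mathcal{R})_g)\subseteq\mathcal{M}_I(\mathcal{R})_{\beta(g)}$ and $\mathcal{M}_I(\mathcal{R})_g\star\mathcal{M}_I(\mathcal{R})_{g'}\subseteq\mathcal{M}_I(\mathcal{R})_{\alpha(g)+\beta(g')}$.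 The support is $\Sigma:=\{g\in G\setminus\{\mathbf{0}\}\mid \mathcal{M}_I(\mathcal{R})_g\neq 0\}$. It is assumed symmetric: $g\in\Sigma$ implies $-g\in\Sigma$. Connections. For $g,g'\in\Sigma$, a connection from $g$ to $g'$ is a finite sequence $g_1,\dots,g_k$ of elements of $\Sigma$ ($k\ge 1$) such that: if $k=1$, then $g_1\in\{\alpha^i\circ\beta^j(g)\mid i,j\in\mathbb{N}\}\cap\{\pm\alpha^m\circ\beta^n(g')\mid m,n\in\mathbb{N}\}$; if $k\ge 2$, then (1) $g_1\in\{\alpha^i\circ\beta^j(g)\mid i,j\in\mathbb{N}\}$, (2) for every $2\le l\le k-1$ the element $\alpha^{l-1}(g_1)+\sum_{t=2}^{l}\alpha^{l-t}\circ\beta(g_t)$ belongs to $\Sigma$, and (3) $\alpha^{k-1}(g_1)+\sum_{t=2}^{k}\alpha^{k-t}\circ\beta(g_t)\in\{\pm\alpha^m\circ\beta^n(g')\mid m,n\in\mathbb{N}\}$. Write $g\sim g'$ if a connection from $g$ to $g'$ exists; $\sim$ is an equivalence relation on $\Sigma$, $[g]$ denotes the class of $g$, and $\Sigma/\sim$ is the set of classes. For $g\in\Sigma$ put $\mathfrak{I}_{\mathbf{0},[g]}:=\operatorname{Span}_{\mathcal{R}}\{\mathcal{M}_I(\mathcal{R})_{\beta(g')}\star\mathcal{M}_I(\mathcal{R})_{-\alpha(g')}\mid g'\in[g]\}\subseteq\mathcal{M}_I(\mathcal{R})_{\mathbf{0}}$, $V_{[g]}:=\bigoplus_{g'\in[g]}\mathcal{M}_I(\mathcal{R})_{g'}$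 and $\mathfrak{I}_{[g]}:=\mathfrak{I}_{\mathbf{0},[g]}\oplus V_{[g]}$. A graded ideal of $(\mathcal{M}_I(\mathcal{R}),\star,\psi,\phi)$ is an $\mathcal{R}$-submodule $\mathfrak{I}$ with $\mathfrak{I}\star\mathcal{M}_I(\mathcal{R})+\mathcal{M}_I(\mathcal{R})\star\mathfrak{I}\subseteq\mathfrak{I}$, $\psi(\mathfrak{I})=\mathfrak{I}$, $\phi(\mathfrak{I})=\mathfrak{I}$, and $\mathfrak{I}=\bigoplus_{g\in G}(\mathfrak{I}\cap\mathcal{M}_I(\mathcal{R})_g)$. *)

theory Defs
  imports Main "HOL.Hull"
    "HOL-Library.Function_Algebras"
    "HOL-Library.Set_Algebras"
    "HOL-Library.Groups_Big_Fun"
begin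

text \<open>
  The index set is an arbitrary (possibly empty) set \<open>I\<close> of indices of type \<open>'i\<close>. A matrix is a
  function \<open>'i \<Rightarrow> 'i \<Rightarrow> 'r\<close>; addition, zero and negation are the pointwise ones of
  \<open>HOL-Library.Function_Algebras\<close>. The pointwise product \<open>*\<close> of that theory is the
  Hadamard product and is never used on matrices.
  The coefficient ring is of class \<open>comm_ring\<close>, so that the zero ring is included and no unit
  is needed.
\<close>

type_synonym ('i, 'r) mat = "'i \<Rightarrow> 'i \<Rightarrow> 'r"

definition mats :: "'i set \<Rightarrow> ('i, 'r::comm_ring) mat set" where
  "mats I = {A. finite {(i, j). A i j \<noteq> 0} \<and> {(i, j). A i j \<noteq> 0} \<subseteq> I \<times> I}"

definition mat_scale :: "'r::comm_ring \<Rightarrow> ('i, 'r) mat \<Rightarrow> ('i, 'r) mat" where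
  "mat_scale r A = (\<lambda>i j. r * A i j)"

text \<open>The sum is \<^const>\<open>Sum_any\<close>; for matrices in \<open>mats I\<close> it has only finitely many non-zero terms.\<close>

definition mat_mult :: "('i, 'r::comm_ring) mat \<Rightarrow> ('i, 'r) mat \<Rightarrow> ('i, 'r) mat" where
  "mat_mult A B = (\<lambda>i j. \<Sum>k. A i k * B k j)"

text \<open>Closure under negation is required separately, since \<open>'r\<close> need not have a unit.\<close>

definition submodule :: "('i, 'r::comm_ring) mat set \<Rightarrow> bool" where
  "submodule S \<longleftrightarrow> 0 \<in> S \<and> (\<forall>x\<in>S. \<forall>y\<in>S. x + y \<in> S) \<and> (\<forall>x\<in>S. - x \<in> S) \<and>
     (\<forall>r. \<forall>x\<in>S. mat_scale r x \<in> S)"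

definition lin_span :: "('i, 'r::comm_ring) mat set \<Rightarrow> ('i, 'r) mat set" where
  "lin_span X = submodule hull X"

definition family_sum :: "'x set \<Rightarrow> ('x \<Rightarrow> ('i, 'r::comm_ring) mat set) \<Rightarrow> ('i, 'r) mat set" where
  "family_sum X N = {\<Sum>x\<in>F. m x | F m. finite F \<and> F \<subseteq> X \<and> (\<forall>x\<in>F. m x \<in> N x)}"

definition is_direct_sum ::
    "('i, 'r::comm_ring) mat set \<Rightarrow> 'x set \<Rightarrow> ('x \<Rightarrow> ('i, 'r) mat set) \<Rightarrow> bool" where
  "is_direct_sum S X N \<longleftrightarrow> S = family_sum X N \<and>
     (\<forall>F m. finite F \<longrightarrow> F \<subseteq> X \<longrightarrow> (\<forall>x\<in>F. m x \<in> N x) \<longrightarrow> (\<Sum>x\<in>F. m x) = 0 \<longrightarrow> (\<forall>x\<in>F. m x = 0))"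

text \<open>Only the restriction of \<open>f\<close> to \<open>mats I\<close> matters.\<close>

definition mat_alg_automorphism ::
    "'i set \<Rightarrow> (('i, 'r::comm_ring) mat \<Rightarrow> ('i, 'r) mat) \<Rightarrow> bool" where
  "mat_alg_automorphism I f \<longleftrightarrow> bij_betw f (mats I) (mats I) \<and>
     (\<forall>A\<in>mats I. \<forall>B\<in>mats I. f (A + B) = f A + f B) \<and>
     (\<forall>r. \<forall>A\<in>mats I. f (mat_scale r A) = mat_scale r (f A)) \<and>
     (\<forall>A\<in>mats I. \<forall>B\<in>mats I. f (mat_mult A B) = mat_mult (f A) (f B))"

definition group_automorphism :: "('g::ab_group_add \<Rightarrow> 'g) \<Rightarrow> bool" where
  "group_automorphism f \<longleftrightarrow> bij f \<and> (\<forall>x y. f (x + y) = f x + f y)"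

definition star ::
    "(('i, 'r::comm_ring) mat \<Rightarrow> ('i, 'r) mat) \<Rightarrow> (('i, 'r) mat \<Rightarrow> ('i, 'r) mat) \<Rightarrow>
     ('i, 'r) mat \<Rightarrow> ('i, 'r) mat \<Rightarrow> ('i, 'r) mat" where
  "star \<psi> \<phi> x y = mat_mult (\<psi> x) (\<phi> y)"

definition star_set ::
    "(('i, 'r::comm_ring) mat \<Rightarrow> ('i, 'r) mat) \<Rightarrow> (('i, 'r) mat \<Rightarrow> ('i, 'r) mat) \<Rightarrow>
     ('i, 'r) mat set \<Rightarrow> ('i, 'r) mat set \<Rightarrow> ('i, 'r) mat set" where
  "star_set \<psi> \<phi> X Y = lin_span {star \<psi> \<phi> x y | x y. x \<in> X \<and> y \<in> Y}"

definition supp :: "('g::ab_group_add \<Rightarrow> ('i, 'r::comm_ring) mat set) \<Rightarrow> 'g set" where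
  "supp M = {g. g \<noteq> 0 \<and> M g \<noteq> {0}}"

definition orbit :: "('g \<Rightarrow> 'g) \<Rightarrow> ('g \<Rightarrow> 'g) \<Rightarrow> 'g::ab_group_add \<Rightarrow> 'g set" where
  "orbit \<alpha> \<beta> g = {(\<alpha> ^^ i) ((\<beta> ^^ j) g) | i j. True}"

definition pm_orbit :: "('g \<Rightarrow> 'g) \<Rightarrow> ('g \<Rightarrow> 'g) \<Rightarrow> 'g::ab_group_add \<Rightarrow> 'g set" where
  "pm_orbit \<alpha> \<beta> g = orbit \<alpha> \<beta> g \<union> uminus ` orbit \<alpha> \<beta> g"

text \<open>
  Sequences \<open>g\<^sub>1, \<dots>, g\<^sub>k\<close> are lists, the entry \<open>g\<^sub>t\<close> being \<open>gs ! (t - 1)\<close>. For \<open>1 \<le> l \<le> k\<close>,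
  \<open>partial_sum \<alpha> \<beta> gs l\<close> is the element attached to the initial segment of length \<open>l\<close>.
\<close>

definition partial_sum ::
    "('g \<Rightarrow> 'g) \<Rightarrow> ('g \<Rightarrow> 'g) \<Rightarrow> 'g::ab_group_add list \<Rightarrow> nat \<Rightarrow> 'g" where
  "partial_sum \<alpha> \<beta> gs l =
     (\<alpha> ^^ (l - 1)) (gs ! 0) + (\<Sum>t = 2..l. (\<alpha> ^^ (l - t)) (\<beta> (gs ! (t - 1))))"

definition is_connection ::
    "('g \<Rightarrow> 'g) \<Rightarrow> ('g \<Rightarrow> 'g) \<Rightarrow> 'g set \<Rightarrow> 'g::ab_group_add \<Rightarrow> 'g \<Rightarrow> 'g list \<Rightarrow> bool" where
  "is_connection \<alpha> \<beta> \<Sigma> g g' gs \<longleftrightarrow> gs \<noteq> [] \<and> set gs \<subseteq> \<Sigma> \<and>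
     (if length gs = 1 then gs ! 0 \<in> orbit \<alpha> \<beta> g \<inter> pm_orbit \<alpha> \<beta> g'
      else gs ! 0 \<in> orbit \<alpha> \<beta> g \<and>
           (\<forall>l. 2 \<le> l \<and> l \<le> length gs - 1 \<longrightarrow> partial_sum \<alpha> \<beta> gs l \<in> \<Sigma>) \<and>
           partial_sum \<alpha> \<beta> gs (length gs) \<in> pm_orbit \<alpha> \<beta> g')"

definition connected ::
    "('g \<Rightarrow> 'g) \<Rightarrow> ('g \<Rightarrow> 'g) \<Rightarrow> 'g::ab_group_add set \<Rightarrow> ('g \<times> 'g) set" where
  "connected \<alpha> \<beta> \<Sigma> = {(g, g'). g \<in> \<Sigma> \<and> g' \<in> \<Sigma> \<and> (\<exists>gs. is_connection \<alpha> \<beta> \<Sigma> g g' gs)}"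

text \<open>In the following, \<open>C\<close> stands for a class \<open>[g]\<close>.\<close>

definition ideal_zero ::
    "(('i, 'r::comm_ring) mat \<Rightarrow> ('i, 'r) mat) \<Rightarrow> (('i, 'r) mat \<Rightarrow> ('i, 'r) mat) \<Rightarrow>
     ('g::ab_group_add \<Rightarrow> 'g) \<Rightarrow> ('g \<Rightarrow> 'g) \<Rightarrow> ('g \<Rightarrow> ('i, 'r) mat set) \<Rightarrow> 'g set \<Rightarrow>
     ('i, 'r) mat set" where
  "ideal_zero \<psi> \<phi> \<alpha> \<beta> M C = lin_span (\<Union>g'\<in>C. star_set \<psi> \<phi> (M (\<beta> g')) (M (- \<alpha> g')))"

definition ideal_V ::
    "('g::ab_group_add \<Rightarrow> ('i, 'r::comm_ring) mat set) \<Rightarrow> 'g set \<Rightarrow> ('i, 'r) mat set" where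
  "ideal_V M C = family_sum C M"

definition ideal_class ::
    "(('i, 'r::comm_ring) mat \<Rightarrow> ('i, 'r) mat) \<Rightarrow> (('i, 'r) mat \<Rightarrow> ('i, 'r) mat) \<Rightarrow>
     ('g::ab_group_add \<Rightarrow> 'g) \<Rightarrow> ('g \<Rightarrow> 'g) \<Rightarrow> ('g \<Rightarrow> ('i, 'r) mat set) \<Rightarrow> 'g set \<Rightarrow>
     ('i, 'r) mat set" where
  "ideal_class \<psi> \<phi> \<alpha> \<beta> M C = ideal_zero \<psi> \<phi> \<alpha> \<beta> M C + ideal_V M C"

definition graded_ideal ::
    "'i set \<Rightarrow> (('i, 'r::comm_ring) mat \<Rightarrow> ('i, 'r) mat) \<Rightarrow> (('i, 'r) mat \<Rightarrow> ('i, 'r) mat) \<Rightarrow>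
     ('g::ab_group_add \<Rightarrow> ('i, 'r) mat set) \<Rightarrow> ('i, 'r) mat set \<Rightarrow> bool" where
  "graded_ideal I \<psi> \<phi> M J \<longleftrightarrow> submodule J \<and> J \<subseteq> mats I \<and>
     star_set \<psi> \<phi> J (mats I) + star_set \<psi> \<phi> (mats I) J \<subseteq> J \<and>
     \<psi> ` J = J \<and> \<phi> ` J = J \<and>
     is_direct_sum J UNIV (\<lambda>g. J \<inter> M g)"

end

theory Submission imports Defs begin

text \<open>
  The twist by \<open>\<psi>\<close> and \<open>\<phi>\<close> is only apparent. Since \<open>\<psi>\<close> is bijective and the homogeneous
  components are independent, \<open>\<psi>\<close> maps \<open>M g\<close> onto all of \<open>M (\<alpha> g)\<close>, and likewise \<open>\<phi>\<close> maps
  \<open>M g\<close> onto \<open>M (\<beta> g)\<close> (\<open>image_component_eq\<close>). Hence the twisted grading condition says that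
  \<open>M\<close> is a grading for the ordinary matrix product, \<open>M g M h \<subseteq> M (g + h)\<close> (\<open>mult_M\<close>).

  Similarly the only properties of a connection class \<open>C\<close> that matter are that it is stable under
  \<open>\<alpha>\<close>, \<open>\<beta>\<close>, their inverses and negation, and that \<open>c + h\<close> belongs to \<open>C\<close> as soon as \<open>c\<close> is in
  \<open>C\<close> and both \<open>h\<close> and \<open>c + h\<close> are in the support (\<open>saturated_class\<close>). For such a \<open>C\<close> the
  candidate ideal is \<open>J = (\<Sum>c\<in>C. M c M (- c)) + (\<Sum>c\<in>C. M c)\<close>, where every product is the
  ordinary one (\<open>ideal_zero_eq\<close>).

  That \<open>J\<close> absorbs products is checked on homogeneous generators. A product of \<open>M c\<close> with \<open>M h\<close>
  lies in degree \<open>c + h\<close>, which is zero, or in \<open>C\<close>, or carries the zero component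
  (\<open>mult_component_in_J\<close>). For \<open>x y z\<close> with \<open>x\<close> in \<open>M c\<close>, \<open>y\<close> in \<open>M (- c)\<close>, \<open>z\<close> in \<open>M h\<close> and
  \<open>h\<close> a non-zero degree outside \<open>C\<close>, already \<open>y z\<close> vanishes: otherwise \<open>h - c\<close> would be in \<open>C\<close>,
  and then so would \<open>h\<close> (\<open>orthogonal_outside\<close>). Invariance of \<open>J\<close> under \<open>\<psi>\<close> and \<open>\<phi>\<close> follows
  from the stability of \<open>C\<close> (\<open>J_image\<close>), and then the twisted product inherits the absorption
  property from the ordinary one. Finally every degree in the support lies in its own class, so
  that the ideals together with \<open>M 0\<close> exhaust the algebra (\<open>mats_eq_M_0_plus\<close>).
\<close>

section \<open>Finitely supported matrices\<close>

lemma mat_mult_eq_sum: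
  assumes "finite K" and "\<And>k. A i k * B k j \<noteq> 0 \<Longrightarrow> k \<in> K"
  shows "mat_mult A B i j = (\<Sum>k\<in>K. A i k * B k j)"
  unfolding mat_mult_def using assms by (intro Sum_any.expand_superset) auto

definition rows :: "('i, 'r::comm_ring) mat \<Rightarrow> 'i set" where
  "rows A = {i. \<exists>j. A i j \<noteq> 0}"

definition columns :: "('i, 'r::comm_ring) mat \<Rightarrow> 'i set" where
  "columns A = {j. \<exists>i. A i j \<noteq> 0}"

text \<open>
  Working with the sets of non-zero rows and columns instead of the set of non-zero entries gives
  finite ranges over which the sum defining a product can be taken uniformly in its entries.
\<close>

lemma mats_iff:
  "A \<in> mats I \<longleftrightarrow> finite (rows A) \<and> finite (columns A) \<and> rows A \<subseteq> I \<and> columns A \<subseteq> I"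
proof -
  let ?S = "{(i, j). A i j \<noteq> 0}"
  have r: "rows A = fst ` ?S" and c: "columns A = snd ` ?S"
    by (force simp: rows_def columns_def image_iff)+
  have sub: "?S \<subseteq> rows A \<times> columns A"
    by (auto simp: rows_def columns_def)
  show ?thesis
  proof
    assume "A \<in> mats I"
    then show "finite (rows A) \<and> finite (columns A) \<and> rows A \<subseteq> I \<and> columns A \<subseteq> I"
      unfolding r c by (auto simp: mats_def)
  next
    assume "finite (rows A) \<and> finite (columns A) \<and> rows A \<subseteq> I \<and> columns A \<subseteq> I"
    then show "A \<in> mats I"
      unfolding mats_def using sub by (auto intro: finite_subset simp: rows_def columns_def)
  qed
qed

lemma mat_mult_eq_sum_columns:
  assumes "A \<in> mats I" "finite K" "columns A \<subseteq> K"
  shows "mat_mult A B i j = (\<Sum>k\<in>K. A i k * B k j)"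
proof (rule mat_mult_eq_sum[OF assms(2)])
  fix k assume "A i k * B k j \<noteq> 0"
  then have "A i k \<noteq> 0" by (metis mult_zero_left)
  then show "k \<in> K" using assms(3) by (auto simp: columns_def)
qed

lemma mat_mult_eq_sum_rows:
  assumes "B \<in> mats I" "finite K" "rows B \<subseteq> K"
  shows "mat_mult A B i j = (\<Sum>k\<in>K. A i k * B k j)"
proof (rule mat_mult_eq_sum[OF assms(2)])
  fix k assume "A i k * B k j \<noteq> 0"
  then have "B k j \<noteq> 0" by (metis mult_zero_right)
  then show "k \<in> K" using assms(3) by (auto simp: rows_def)
qed

lemma mats_mono:
  "A \<in> mats I \<Longrightarrow> rows B \<subseteq> rows A \<Longrightarrow> columns B \<subseteq> columns A \<Longrightarrow> B \<in> mats I"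
  unfolding mats_iff by (meson finite_subset order_trans)

lemma submodule_mats:
  fixes I :: "'i set"
  shows "submodule (mats I :: ('i, 'r::comm_ring) mat set)"
  unfolding submodule_def
proof (intro conjI ballI allI)
  show "0 \<in> mats I" by (simp add: mats_def)
next
  fix A B :: "('i, 'r::comm_ring) mat" assume "A \<in> mats I" "B \<in> mats I"
  moreover have "rows (A + B) \<subseteq> rows A \<union> rows B"
  proof
    fix i assume "i \<in> rows (A + B)"
    then obtain j where "A i j + B i j \<noteq> 0" by (auto simp: rows_def)
    then have "A i j \<noteq> 0 \<or> B i j \<noteq> 0" by auto
    then show "i \<in> rows A \<union> rows B" by (auto simp: rows_def)
  qed
  moreover have "columns (A + B) \<subseteq> columns A \<union> columns B"
  proof
    fix j assume "j \<in> columns (A + B)"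
    then obtain i where "A i j + B i j \<noteq> 0" by (auto simp: columns_def)
    then have "A i j \<noteq> 0 \<or> B i j \<noteq> 0" by auto
    then show "j \<in> columns A \<union> columns B" by (auto simp: columns_def)
  qed
  ultimately show "A + B \<in> mats I"
    unfolding mats_iff by (meson finite_UnI finite_subset Un_least order_trans)
next
  fix A :: "('i, 'r::comm_ring) mat" assume A: "A \<in> mats I"
  show "- A \<in> mats I"
    using A by (rule mats_mono) (auto simp: rows_def columns_def)
  fix r
  have nz: "mat_scale r A i j \<noteq> 0 \<Longrightarrow> A i j \<noteq> 0" for i j
    by (metis mat_scale_def mult_zero_right)
  show "mat_scale r A \<in> mats I"
    using A by (rule mats_mono) (use nz in \<open>auto simp: rows_def columns_def\<close>)
qed

lemma mat_mult_in_mats: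
  assumes "A \<in> mats I" "B \<in> mats I"
  shows "mat_mult A B \<in> mats I"
proof -
  have nz: "(\<exists>k. A i k \<noteq> 0) \<and> (\<exists>k. B k j \<noteq> 0)" if "mat_mult A B i j \<noteq> 0" for i j
  proof -
    obtain k where "A i k * B k j \<noteq> 0"
      using \<open>mat_mult A B i j \<noteq> 0\<close> unfolding mat_mult_def by (rule Sum_any.not_neutral_obtains_not_neutral)
    then show ?thesis by (metis mult_zero_left mult_zero_right)
  qed
  then have "rows (mat_mult A B) \<subseteq> rows A" "columns (mat_mult A B) \<subseteq> columns B"
    unfolding rows_def columns_def by blast+
  then show ?thesis
    using assms unfolding mats_iff by (meson finite_subset order_trans)
qed

lemma mat_mult_assoc:
  assumes "A \<in> mats I" "B \<in> mats I" "C \<in> mats I"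
  shows "mat_mult (mat_mult A B) C = mat_mult A (mat_mult B C)"
proof (intro ext)
  fix i j
  let ?K = "columns A" and ?L = "rows C"
  have fin: "finite ?K" "finite ?L"
    using assms by (auto simp: mats_iff)
  have "mat_mult (mat_mult A B) C i j = (\<Sum>l\<in>?L. (\<Sum>k\<in>?K. A i k * B k l) * C l j)"
    by (simp add: mat_mult_eq_sum_rows[OF assms(3) fin(2)] mat_mult_eq_sum_columns[OF assms(1) fin(1)])
  also have "\<dots> = (\<Sum>k\<in>?K. A i k * (\<Sum>l\<in>?L. B k l * C l j))"
    unfolding sum_distrib_left sum_distrib_right
    by (subst sum.swap) (simp add: mult.assoc)
  also have "\<dots> = mat_mult A (mat_mult B C) i j"
    by (simp add: mat_mult_eq_sum_rows[OF assms(3) fin(2)] mat_mult_eq_sum_columns[OF assms(1) fin(1)])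
  finally show "mat_mult (mat_mult A B) C i j = mat_mult A (mat_mult B C) i j" .
qed

lemma mat_mult_add_left:
  assumes "C \<in> mats I"
  shows "mat_mult (A + B) C = mat_mult A C + mat_mult B C"
  using assms by (intro ext)
    (simp add: mat_mult_eq_sum_rows[OF assms _ order_refl] mats_iff plus_fun_def distrib_right sum.distrib)

lemma mat_mult_add_right:
  assumes "A \<in> mats I"
  shows "mat_mult A (B + C) = mat_mult A B + mat_mult A C"
  using assms by (intro ext)
    (simp add: mat_mult_eq_sum_columns[OF assms _ order_refl] mats_iff plus_fun_def distrib_left sum.distrib)

lemma mat_mult_zero [simp]: "mat_mult 0 B = 0" "mat_mult A 0 = 0"
  by (simp_all add: mat_mult_def fun_eq_iff zero_fun_def)

lemma mat_mult_scale_left: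
  assumes "C \<in> mats I"
  shows "mat_mult (mat_scale r A) C = mat_scale r (mat_mult A C)"
  using assms by (intro ext)
    (simp add: mat_mult_eq_sum_rows[OF assms _ order_refl] mats_iff mat_scale_def sum_distrib_left mult.assoc)

lemma mat_mult_scale_right:
  assumes "A \<in> mats I"
  shows "mat_mult A (mat_scale r C) = mat_scale r (mat_mult A C)"
  using assms by (intro ext)
    (simp add: mat_mult_eq_sum_columns[OF assms _ order_refl] mats_iff mat_scale_def sum_distrib_left mult.left_commute)

section \<open>Submodules, spans and sums of families\<close>

lemma submodule_zero: "submodule S \<Longrightarrow> 0 \<in> S"
  and submodule_add: "submodule S \<Longrightarrow> x \<in> S \<Longrightarrow> y \<in> S \<Longrightarrow> x + y \<in> S"
  and submodule_minus: "submodule S \<Longrightarrow> x \<in> S \<Longrightarrow> - x \<in> S"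
  and submodule_scale: "submodule S \<Longrightarrow> x \<in> S \<Longrightarrow> mat_scale r x \<in> S"
  by (auto simp: submodule_def)

lemma submodule_diff: "submodule S \<Longrightarrow> x \<in> S \<Longrightarrow> y \<in> S \<Longrightarrow> x - y \<in> S"
  by (metis submodule_add submodule_minus diff_conv_add_uminus)

lemma submodule_sum: "submodule S \<Longrightarrow> (\<And>x. x \<in> F \<Longrightarrow> m x \<in> S) \<Longrightarrow> sum m F \<in> S"
  by (induction F rule: infinite_finite_induct) (auto intro: submodule_zero submodule_add)

lemma mat_scale_zero [simp]: "mat_scale r 0 = 0"
  by (simp add: mat_scale_def fun_eq_iff zero_fun_def)

lemma mat_scale_add: "mat_scale r (A + B) = mat_scale r A + mat_scale r B"
  by (simp add: mat_scale_def fun_eq_iff plus_fun_def distrib_left)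

lemma mat_scale_sum: "mat_scale r (sum m F) = (\<Sum>x\<in>F. mat_scale r (m x))"
  by (induction F rule: infinite_finite_induct) (simp_all only: sum.infinite sum.empty sum.insert mat_scale_zero mat_scale_add simp_thms)

lemma submodule_lin_span: "submodule (lin_span X)"
  unfolding lin_span_def by (rule hull_in) (auto simp: submodule_def)

lemma lin_span_superset: "X \<subseteq> lin_span X"
  unfolding lin_span_def by (rule hull_subset)

lemma lin_span_minimal: "X \<subseteq> S \<Longrightarrow> submodule S \<Longrightarrow> lin_span X \<subseteq> S"
  unfolding lin_span_def by (rule hull_minimal)

lemma lin_span_UN_lin_span: "lin_span (\<Union>x\<in>A. lin_span (X x)) = lin_span (\<Union>x\<in>A. X x)"
proof
  show "lin_span (\<Union>x\<in>A. lin_span (X x)) \<subseteq> lin_span (\<Union>x\<in>A. X x)"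
    by (intro lin_span_minimal submodule_lin_span UN_least)
       (meson UN_upper lin_span_superset order_trans)
  show "lin_span (\<Union>x\<in>A. X x) \<subseteq> lin_span (\<Union>x\<in>A. lin_span (X x))"
    by (intro lin_span_minimal submodule_lin_span UN_least)
       (meson UN_upper lin_span_superset order_trans)
qed

lemma submodule_plus:
  assumes S: "submodule S" and T: "submodule T"
  shows "submodule (S + T)"
  unfolding submodule_def
proof (intro conjI ballI allI)
  show "0 \<in> S + T"
    using set_plus_intro[OF submodule_zero[OF S] submodule_zero[OF T]] by simp
next
  fix x y assume "x \<in> S + T" "y \<in> S + T"
  then obtain s t s' t' where "x = s + t" "y = s' + t'" "s \<in> S" "t \<in> T" "s' \<in> S" "t' \<in> T"
    by (auto elim!: set_plus_elim)
  then have "x + y = (s + s') + (t + t')" "s + s' \<in> S" "t + t' \<in> T"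
    using S T by (auto simp: algebra_simps intro: submodule_add)
  then show "x + y \<in> S + T" by (auto intro: set_plus_intro)
next
  fix x assume "x \<in> S + T"
  then obtain s t where x: "x = s + t" "s \<in> S" "t \<in> T"
    by (auto elim!: set_plus_elim)
  then have "- x = - s + - t" by simp
  then show "- x \<in> S + T"
    using x S T by (metis set_plus_intro submodule_minus)
  fix r show "mat_scale r x \<in> S + T"
    unfolding x(1) mat_scale_add using x S T by (auto intro: set_plus_intro submodule_scale)
qed

lemma plus_superset:
  assumes "submodule S" "submodule T"
  shows "S \<subseteq> S + T" "T \<subseteq> S + T"
  using set_plus_intro[OF _ submodule_zero[OF assms(2)], of _ S]
    set_plus_intro[OF submodule_zero[OF assms(1)], of _ T] by auto

lemma plus_minimal:
  assumes "submodule R" "S \<subseteq> R" "T \<subseteq> R"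
  shows "S + T \<subseteq> R"
  using assms by (auto elim!: set_plus_elim intro: submodule_add)

lemma family_sumE:
  assumes "x \<in> family_sum X N"
  obtains F m where "finite F" "F \<subseteq> X" "\<And>y. y \<in> F \<Longrightarrow> m y \<in> N y" "x = sum m F"
  using assms unfolding family_sum_def by blast

lemma family_sum_superset: "x \<in> X \<Longrightarrow> N x \<subseteq> family_sum X N"
  unfolding family_sum_def
proof
  fix a assume "x \<in> X" "a \<in> N x"
  then show "a \<in> {\<Sum>x\<in>F. m x | F m. finite F \<and> F \<subseteq> X \<and> (\<forall>x\<in>F. m x \<in> N x)}"
    by (intro CollectI exI[of _ "{x}"] exI[of _ "\<lambda>_. a"]) auto
qed

lemma family_sum_minimal:
  assumes "submodule S" "\<And>x. x \<in> X \<Longrightarrow> N x \<subseteq> S"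
  shows "family_sum X N \<subseteq> S"
proof
  fix a assume "a \<in> family_sum X N"
  then show "a \<in> S"
    by (rule family_sumE) (use assms in \<open>auto intro!: submodule_sum\<close>)
qed

lemma submodule_family_sum:
  assumes N: "\<And>x. x \<in> X \<Longrightarrow> submodule (N x)"
  shows "submodule (family_sum X N)"
  unfolding submodule_def
proof (intro conjI ballI allI)
  show "0 \<in> family_sum X N"
    unfolding family_sum_def by (intro CollectI exI[of _ "{}"]) auto
next
  fix a b assume "a \<in> family_sum X N" "b \<in> family_sum X N"
  then obtain F m F' m' where
    F: "finite F" "F \<subseteq> X" "\<And>y. y \<in> F \<Longrightarrow> m y \<in> N y" "a = sum m F" and
    F': "finite F'" "F' \<subseteq> X" "\<And>y. y \<in> F' \<Longrightarrow> m' y \<in> N y" "b = sum m' F'"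
    by (metis family_sumE)
  \<comment> \<open>Both families are extended by zero to the union of their index sets.\<close>
  define n where "n y = (if y \<in> F then m y else 0) + (if y \<in> F' then m' y else 0)" for y
  have "a + b = sum n (F \<union> F')"
    unfolding n_def sum.distrib F F' using F(1) F'(1)
    by (simp add: sum.If_cases Int_absorb1 Int_commute)
  moreover have "n y \<in> N y" if "y \<in> F \<union> F'" for y
    using that F F' N unfolding n_def by (auto intro!: submodule_add intro: submodule_zero)
  ultimately show "a + b \<in> family_sum X N"
    using F F' unfolding family_sum_def
    by (intro CollectI exI[of _ "F \<union> F'"] exI[of _ n]) auto
next
  fix a assume "a \<in> family_sum X N"
  then obtain F m where
    F: "finite F" "F \<subseteq> X" "\<And>y. y \<in> F \<Longrightarrow> m y \<in> N y" "a = sum m F"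
    by (metis family_sumE)
  show "- a \<in> family_sum X N"
    unfolding family_sum_def F(4) sum_negf[symmetric]
    by (intro CollectI exI[of _ F] exI[of _ "\<lambda>y. - m y"])
       (use F N in \<open>auto intro!: submodule_minus\<close>)
  fix r show "mat_scale r a \<in> family_sum X N"
    unfolding family_sum_def F(4) mat_scale_sum
    by (intro CollectI exI[of _ F] exI[of _ "\<lambda>y. mat_scale r (m y)"])
       (use F N in \<open>auto intro!: submodule_scale\<close>)
qed

text \<open>
  Subtracting the total from the summand of degree \<open>x\<close> produces a family with sum zero, to which
  the independence of the \<open>N x\<close> applies.
\<close>

lemma direct_sum_component:
  assumes dir: "is_direct_sum S X N" and N: "\<And>x. x \<in> X \<Longrightarrow> submodule (N x)"
    and F: "finite F" "F \<subseteq> X" "\<And>y. y \<in> F \<Longrightarrow> m y \<in> N y"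
    and x: "x \<in> X" "sum m F \<in> N x" and y: "y \<in> F" "y \<noteq> x"
  shows "m y = 0"
proof -
  \<comment> \<open>The degree \<open>x\<close> need not occur in \<open>F\<close>, so the family is first extended by zero.\<close>
  define n where "n z = (if z \<in> F then m z else 0) - (if z = x then sum m F else 0)" for z
  have "sum n (insert x F) = 0"
    unfolding n_def sum_subtractf using F(1) by (simp add: sum.If_cases Int_absorb1 insert_absorb subset_insertI)
  moreover have "n z \<in> N z" if "z \<in> insert x F" for z
    using that F x N unfolding n_def
    by (intro submodule_diff) (auto intro: submodule_zero)
  ultimately have "n y = 0"
    using dir F x y unfolding is_direct_sum_def by (metis finite_insert insert_subset insertCI)
  then show ?thesis using y by (simp add: n_def)
qed

subsection \<open>Linear images\<close>

text \<open>
  The restriction to \<open>mats I\<close> makes room for the automorphisms, about which nothing is known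
  elsewhere, next to the one-sided multiplications.
\<close>

definition mat_linear_on :: "'i set \<Rightarrow> (('i, 'r::comm_ring) mat \<Rightarrow> ('i, 'r) mat) \<Rightarrow> bool" where
  "mat_linear_on I f \<longleftrightarrow> (\<forall>A\<in>mats I. f A \<in> mats I) \<and>
     (\<forall>A\<in>mats I. \<forall>B\<in>mats I. f (A + B) = f A + f B) \<and>
     (\<forall>r. \<forall>A\<in>mats I. f (mat_scale r A) = mat_scale r (f A))"

lemma mat_linear_on_zero: "mat_linear_on I f \<Longrightarrow> f 0 = 0"
  using submodule_zero[OF submodule_mats, of I] unfolding mat_linear_on_def
  by (metis add.right_neutral add_left_cancel)

lemma mat_linear_on_minus: "mat_linear_on I f \<Longrightarrow> A \<in> mats I \<Longrightarrow> f (- A) = - f A"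
  using mat_linear_on_zero[of I f] submodule_minus[OF submodule_mats, of A I]
  unfolding mat_linear_on_def by (metis add.right_inverse add_eq_0_iff)

lemma mat_linear_on_sum:
  assumes "mat_linear_on I f" "\<And>x. x \<in> F \<Longrightarrow> m x \<in> mats I"
  shows "f (sum m F) = (\<Sum>x\<in>F. f (m x))"
  using assms(2)
proof (induction F rule: infinite_finite_induct)
  case (insert x F)
  then have "sum m F \<in> mats I" by (auto intro: submodule_sum submodule_mats)
  then have "f (m x + sum m F) = f (m x) + f (sum m F)"
    using insert.prems assms(1) unfolding mat_linear_on_def by blast
  then show ?case using insert by (simp only: sum.insert insertI2 simp_thms)
qed (simp_all only: sum.infinite sum.empty mat_linear_on_zero[OF assms(1)] simp_thms)

lemma submodule_image:
  assumes f: "mat_linear_on I f" and S: "submodule S" "S \<subseteq> mats I"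
  shows "submodule (f ` S)"
  unfolding submodule_def
proof (intro conjI ballI allI)
  show "0 \<in> f ` S"
    using mat_linear_on_zero[OF f] submodule_zero[OF S(1)] by force
next
  fix x y assume "x \<in> f ` S" "y \<in> f ` S"
  then obtain a b where "x = f a" "y = f b" "a \<in> S" "b \<in> S" by auto
  moreover from this have "f (a + b) = f a + f b"
    using f S(2) unfolding mat_linear_on_def by blast
  ultimately show "x + y \<in> f ` S"
    using submodule_add[OF S(1)] by (metis imageI)
next
  fix x assume "x \<in> f ` S"
  then obtain a where a: "x = f a" "a \<in> S" by auto
  moreover have "f (- a) = - f a" using mat_linear_on_minus f S(2) a by blast
  ultimately show "- x \<in> f ` S"
    using submodule_minus[OF S(1)] by (metis imageI)
  fix r
  have "f (mat_scale r a) = mat_scale r (f a)" using f S(2) a by (auto simp: mat_linear_on_def)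
  then show "mat_scale r x \<in> f ` S"
    using a submodule_scale[OF S(1)] by (metis imageI)
qed

lemma submodule_vimage:
  assumes f: "mat_linear_on I f" and S: "submodule S"
  shows "submodule {x \<in> mats I. f x \<in> S}"
  using f S submodule_mats[of I] mat_linear_on_zero[OF f] mat_linear_on_minus[OF f]
  unfolding submodule_def mat_linear_on_def by auto

lemma mat_linear_on_mult_left:
  "A \<in> mats I \<Longrightarrow> mat_linear_on I (mat_mult A)"
  by (auto simp: mat_linear_on_def mat_mult_in_mats mat_mult_add_right mat_mult_scale_right)

lemma mat_linear_on_mult_right:
  "A \<in> mats I \<Longrightarrow> mat_linear_on I (\<lambda>B. mat_mult B A)"
  by (auto simp: mat_linear_on_def mat_mult_in_mats mat_mult_add_left mat_mult_scale_left)

lemma mat_alg_automorphism_linear: "mat_alg_automorphism I f \<Longrightarrow> mat_linear_on I f"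
  by (auto simp: mat_alg_automorphism_def mat_linear_on_def bij_betw_def)

lemma automorphism_eq_0_iff:
  assumes "mat_alg_automorphism I f" "A \<in> mats I"
  shows "f A = 0 \<longleftrightarrow> A = 0"
  using assms mat_linear_on_zero[OF mat_alg_automorphism_linear[OF assms(1)]]
    submodule_zero[OF submodule_mats, of I]
  unfolding mat_alg_automorphism_def bij_betw_def by (metis inj_onD)

section \<open>Connection classes\<close>

lemma group_automorphism_simps:
  assumes "group_automorphism f"
  shows "f (x + y) = f x + f y" "f 0 = 0" "f (- x) = - f x" "f x = f y \<longleftrightarrow> x = y" "f x = 0 \<longleftrightarrow> x = 0"
proof -
  show add: "f (x + y) = f x + f y" for x y using assms by (simp add: group_automorphism_def)
  show 0: "f 0 = 0" using add[of 0 0] by simp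
  show "f (- x) = - f x" using add[of x "- x"] 0 by (simp add: eq_neg_iff_add_eq_0 add.commute)
  show "f x = f y \<longleftrightarrow> x = y" for x y
    using assms by (auto simp: group_automorphism_def bij_def inj_def)
  from this[of x 0] 0 show "f x = 0 \<longleftrightarrow> x = 0" by simp
qed

lemma group_automorphism_surj: "group_automorphism f \<Longrightarrow> \<exists>x. y = f x"
  by (auto simp: group_automorphism_def bij_def)

lemma group_automorphism_funpow: "group_automorphism f \<Longrightarrow> group_automorphism (f ^^ n)"
  by (induction n) (auto simp: group_automorphism_def bij_comp)

text \<open>
  The condition on sums uses the plain addition of the group rather than the twisted sums of the
  connections; the two agree because \<open>C\<close> and \<open>\<Sigma>\<close> are stable under \<open>\<alpha>\<close> and \<open>\<beta>\<close>.
\<close>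

definition saturated ::
    "('g \<Rightarrow> 'g) \<Rightarrow> ('g \<Rightarrow> 'g) \<Rightarrow> 'g::ab_group_add set \<Rightarrow> 'g set \<Rightarrow> bool" where
  "saturated \<alpha> \<beta> \<Sigma> C \<longleftrightarrow> C \<subseteq> \<Sigma> \<and> (\<forall>c. \<alpha> c \<in> C \<longleftrightarrow> c \<in> C) \<and> (\<forall>c. \<beta> c \<in> C \<longleftrightarrow> c \<in> C) \<and>
     (\<forall>c. - c \<in> C \<longleftrightarrow> c \<in> C) \<and> (\<forall>c\<in>C. \<forall>h\<in>\<Sigma>. c + h \<in> \<Sigma> \<longrightarrow> c + h \<in> C)"

lemma partial_sum_1: "partial_sum \<alpha> \<beta> gs (Suc 0) = gs ! 0"
  by (simp add: partial_sum_def)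

lemma partial_sum_append:
  assumes "1 \<le> l" "l \<le> length gs"
  shows "partial_sum \<alpha> \<beta> (gs @ hs) l = partial_sum \<alpha> \<beta> gs l"
proof -
  have "gs \<noteq> []" using assms by auto
  then show ?thesis
    unfolding partial_sum_def using assms by (auto simp: nth_append intro!: sum.cong)
qed

text \<open>
  For lists of length one the partial sum is the entry itself and the condition on intermediate
  sums is vacuous, so the two cases of the definition merge.
\<close>

lemma is_connection_iff:
  "is_connection \<alpha> \<beta> \<Sigma> g g' gs \<longleftrightarrow> gs \<noteq> [] \<and> set gs \<subseteq> \<Sigma> \<and> gs ! 0 \<in> orbit \<alpha> \<beta> g \<and>
     (\<forall>l. 2 \<le> l \<and> l < length gs \<longrightarrow> partial_sum \<alpha> \<beta> gs l \<in> \<Sigma>) \<and>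
     partial_sum \<alpha> \<beta> gs (length gs) \<in> pm_orbit \<alpha> \<beta> g'"
  by (cases "length gs = 1") (auto simp: is_connection_def partial_sum_1 less_Suc_eq_le[symmetric])

locale commuting_automorphisms =
  fixes \<alpha> \<beta> :: "'g::ab_group_add \<Rightarrow> 'g" and \<Sigma> :: "'g set"
  assumes \<alpha>: "group_automorphism \<alpha>" and \<beta>: "group_automorphism \<beta>"
    and commute: "\<alpha> \<circ> \<beta> = \<beta> \<circ> \<alpha>"
    and \<alpha>_\<Sigma>: "\<alpha> g \<in> \<Sigma> \<longleftrightarrow> g \<in> \<Sigma>" and \<beta>_\<Sigma>: "\<beta> g \<in> \<Sigma> \<longleftrightarrow> g \<in> \<Sigma>"
    and uminus_\<Sigma>: "g \<in> \<Sigma> \<Longrightarrow> - g \<in> \<Sigma>"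
begin

lemmas \<alpha>_simps = group_automorphism_simps[OF \<alpha>]
lemmas \<beta>_simps = group_automorphism_simps[OF \<beta>]

lemma \<alpha>\<beta>: "\<alpha> (\<beta> x) = \<beta> (\<alpha> x)"
  using commute by (metis comp_apply)

lemma pow_commute:
  "(\<alpha> ^^ m) (\<beta> x) = \<beta> ((\<alpha> ^^ m) x)" "(\<beta> ^^ n) (\<alpha> x) = \<alpha> ((\<beta> ^^ n) x)"
  "(\<alpha> ^^ m) (\<alpha> x) = \<alpha> ((\<alpha> ^^ m) x)" "(\<beta> ^^ n) (\<beta> x) = \<beta> ((\<beta> ^^ n) x)"
proof -
  show "(\<alpha> ^^ m) (\<beta> x) = \<beta> ((\<alpha> ^^ m) x)" by (induction m) (simp_all add: \<alpha>\<beta>)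
  show "(\<beta> ^^ n) (\<alpha> x) = \<alpha> ((\<beta> ^^ n) x)" by (induction n) (simp_all add: \<alpha>\<beta>)
  show "(\<alpha> ^^ m) (\<alpha> x) = \<alpha> ((\<alpha> ^^ m) x)" "(\<beta> ^^ n) (\<beta> x) = \<beta> ((\<beta> ^^ n) x)"
    by (simp_all add: funpow_swap1)
qed

lemma pow_\<Sigma>: "(\<alpha> ^^ m) ((\<beta> ^^ n) g) \<in> \<Sigma> \<longleftrightarrow> g \<in> \<Sigma>"
proof -
  have "(\<beta> ^^ n) g \<in> \<Sigma> \<longleftrightarrow> g \<in> \<Sigma>" by (induction n) (auto simp: \<beta>_\<Sigma>)
  then show ?thesis by (induction m) (auto simp: \<alpha>_\<Sigma>)
qed

lemma uminus_\<Sigma>_iff: "- g \<in> \<Sigma> \<longleftrightarrow> g \<in> \<Sigma>"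
  using uminus_\<Sigma>[of g] uminus_\<Sigma>[of "- g"] by auto

text \<open>
  The recursion behind the closed formula: a twisted product of degrees \<open>s\<close> and \<open>h\<close> has
  degree \<open>\<alpha> s + \<beta> h\<close>.
\<close>

lemma partial_sum_Suc:
  assumes "1 \<le> l"
  shows "partial_sum \<alpha> \<beta> gs (Suc l) = \<alpha> (partial_sum \<alpha> \<beta> gs l) + \<beta> (gs ! l)"
proof -
  have "(\<Sum>t = 2..l. (\<alpha> ^^ (Suc l - t)) (\<beta> (gs ! (t - 1)))) =
      \<alpha> (\<Sum>t = 2..l. (\<alpha> ^^ (l - t)) (\<beta> (gs ! (t - 1))))"
    by (subst sum_comp_morphism[of \<alpha>, symmetric, unfolded comp_def])
       (auto simp: \<alpha>_simps Suc_diff_le intro!: sum.cong)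
  then show ?thesis
    using assms
    by (cases l) (auto simp: partial_sum_def \<alpha>_simps sum.atLeast_Suc_atMost_Suc_shift add.assoc)
qed

lemma pm_orbit_iff:
  "x \<in> pm_orbit \<alpha> \<beta> g \<longleftrightarrow> (\<exists>m n. x = (\<alpha> ^^ m) ((\<beta> ^^ n) g) \<or> x = - (\<alpha> ^^ m) ((\<beta> ^^ n) g))"
  unfolding pm_orbit_def orbit_def Un_iff image_iff mem_Collect_eq by blast

lemma pm_orbit_\<Sigma>: "x \<in> pm_orbit \<alpha> \<beta> g \<Longrightarrow> x \<in> \<Sigma> \<longleftrightarrow> g \<in> \<Sigma>"
  by (auto simp: pm_orbit_iff uminus_\<Sigma>_iff pow_\<Sigma>)

lemma pow_uminus: "(\<alpha> ^^ m) ((\<beta> ^^ n) (- g)) = - (\<alpha> ^^ m) ((\<beta> ^^ n) g)"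
  by (simp add: group_automorphism_simps[OF group_automorphism_funpow[OF \<alpha>]]
      group_automorphism_simps[OF group_automorphism_funpow[OF \<beta>]])

lemma pm_orbit_uminus: "pm_orbit \<alpha> \<beta> (- g) = pm_orbit \<alpha> \<beta> g"
proof (rule set_eqI)
  show "x \<in> pm_orbit \<alpha> \<beta> (- g) \<longleftrightarrow> x \<in> pm_orbit \<alpha> \<beta> g" for x
    unfolding pm_orbit_iff pow_uminus minus_minus by blast
qed

lemma pm_orbit_image_subset:
  "pm_orbit \<alpha> \<beta> (\<alpha> g) \<subseteq> pm_orbit \<alpha> \<beta> g" "pm_orbit \<alpha> \<beta> (\<beta> g) \<subseteq> pm_orbit \<alpha> \<beta> g"
proof -
  have "(\<alpha> ^^ m) ((\<beta> ^^ n) (\<alpha> g)) = (\<alpha> ^^ Suc m) ((\<beta> ^^ n) g)"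
    "(\<alpha> ^^ m) ((\<beta> ^^ n) (\<beta> g)) = (\<alpha> ^^ m) ((\<beta> ^^ Suc n) g)" for m n
    by (simp_all add: pow_commute)
  note pow = this
  show "pm_orbit \<alpha> \<beta> (\<alpha> g) \<subseteq> pm_orbit \<alpha> \<beta> g"
    unfolding subset_eq Ball_def pm_orbit_iff pow by blast
  show "pm_orbit \<alpha> \<beta> (\<beta> g) \<subseteq> pm_orbit \<alpha> \<beta> g"
    unfolding subset_eq Ball_def pm_orbit_iff pow by blast
qed

lemma connected_refl:
  assumes "g \<in> \<Sigma>"
  shows "(g, g) \<in> connected \<alpha> \<beta> \<Sigma>"
proof -
  have "g = (\<alpha> ^^ 0) ((\<beta> ^^ 0) g)" by simp
  then have "g \<in> orbit \<alpha> \<beta> g" unfolding orbit_def by blast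
  then have "is_connection \<alpha> \<beta> \<Sigma> g g [g]"
    using assms by (auto simp: is_connection_iff partial_sum_1 pm_orbit_def)
  then show ?thesis using assms by (auto simp: connected_def)
qed

text \<open>
  Since \<open>\<alpha>\<close> and \<open>\<beta>\<close> commute with the formation of partial sums, a whole connection may be
  transported along either of them. This replaces negative powers, which orbits do not contain.
\<close>

lemma is_connection_map:
  assumes conn: "is_connection \<alpha> \<beta> \<Sigma> g g' gs" and \<gamma>: "\<gamma> = \<alpha> \<or> \<gamma> = \<beta>"
  shows "is_connection \<alpha> \<beta> \<Sigma> g (\<gamma> g') (map \<gamma> gs)"
proof -
  have aut: "group_automorphism \<gamma>" and comm: "\<gamma> (\<alpha> x) = \<alpha> (\<gamma> x)" "\<gamma> (\<beta> x) = \<beta> (\<gamma> x)"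
    and \<gamma>_\<Sigma>: "\<gamma> x \<in> \<Sigma> \<longleftrightarrow> x \<in> \<Sigma>" for x
    using \<gamma> \<alpha> \<beta> by (auto simp: \<alpha>\<beta> \<alpha>_\<Sigma> \<beta>_\<Sigma>)
  have ps: "partial_sum \<alpha> \<beta> (map \<gamma> gs) l = \<gamma> (partial_sum \<alpha> \<beta> gs l)"
    if "1 \<le> l" "l \<le> length gs" for l
    using that
  proof (induction l rule: dec_induct)
    case base
    then show ?case by (simp add: partial_sum_1 nth_map Suc_le_eq del: length_greater_0_conv)
  next
    case (step l)
    then show ?case by (simp add: partial_sum_Suc group_automorphism_simps[OF aut] comm)
  qed
  have pow: "\<gamma> ((\<alpha> ^^ m) ((\<beta> ^^ n) x)) = (\<alpha> ^^ m) ((\<beta> ^^ n) (\<gamma> x))" for m n x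
    using \<gamma> by (auto simp: pow_commute)
  have "\<gamma> x \<in> orbit \<alpha> \<beta> g" if "x \<in> orbit \<alpha> \<beta> g" for x
  proof -
    obtain m n where "x = (\<alpha> ^^ m) ((\<beta> ^^ n) g)"
      using \<open>x \<in> orbit \<alpha> \<beta> g\<close> unfolding orbit_def by blast
    then have "\<gamma> x = (\<alpha> ^^ Suc m) ((\<beta> ^^ n) g) \<or> \<gamma> x = (\<alpha> ^^ m) ((\<beta> ^^ Suc n) g)"
      using \<gamma> by (auto simp: pow_commute)
    then show ?thesis unfolding orbit_def by blast
  qed
  moreover have "\<gamma> x \<in> pm_orbit \<alpha> \<beta> (\<gamma> g')" if "x \<in> pm_orbit \<alpha> \<beta> g'" for x
  proof -
    obtain m n where "x = (\<alpha> ^^ m) ((\<beta> ^^ n) g') \<or> x = - (\<alpha> ^^ m) ((\<beta> ^^ n) g')"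
      using \<open>x \<in> pm_orbit \<alpha> \<beta> g'\<close> unfolding pm_orbit_iff by blast
    then have "\<gamma> x = (\<alpha> ^^ m) ((\<beta> ^^ n) (\<gamma> g')) \<or> \<gamma> x = - (\<alpha> ^^ m) ((\<beta> ^^ n) (\<gamma> g'))"
      unfolding pow[symmetric] using group_automorphism_simps(3)[OF aut] by metis
    then show ?thesis unfolding pm_orbit_iff by blast
  qed
  ultimately show ?thesis
    using conn by (auto simp: is_connection_iff ps \<gamma>_\<Sigma> Suc_le_eq)
qed

text \<open>
  The connection to \<open>c\<close> ends in \<open>s = \<plusminus> \<alpha>\<^sup>m \<beta>\<^sup>n c\<close>. One more step leads from \<open>s\<close> to \<open>\<alpha> s + \<beta> k\<close>;
  choosing \<open>\<beta> k = \<plusminus> \<alpha>\<^sup>m\<^sup>+\<^sup>1 \<beta>\<^sup>n h\<close> with the same sign turns this into \<open>\<plusminus> \<alpha>\<^sup>m\<^sup>+\<^sup>1 \<beta>\<^sup>n (c + h)\<close>.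
\<close>

lemma is_connection_snoc:
  assumes conn: "is_connection \<alpha> \<beta> \<Sigma> g c gs" and c: "c \<in> \<Sigma>" and h: "h \<in> \<Sigma>"
  obtains k where "is_connection \<alpha> \<beta> \<Sigma> g (c + h) (gs @ [k])"
proof -
  define s where "s = partial_sum \<alpha> \<beta> gs (length gs)"
  have "s \<in> pm_orbit \<alpha> \<beta> c" and len: "1 \<le> length gs"
    using conn by (auto simp: is_connection_iff s_def Suc_le_eq)
  then obtain m n and \<epsilon> :: "'g \<Rightarrow> 'g" where s: "s = \<epsilon> ((\<alpha> ^^ m) ((\<beta> ^^ n) c))"
    and \<epsilon>: "\<epsilon> = id \<or> \<epsilon> = uminus"
    unfolding pm_orbit_iff by (metis id_apply)
  define p where "p x = \<epsilon> ((\<alpha> ^^ Suc m) ((\<beta> ^^ n) x))" for x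
  have p_add: "p (x + y) = p x + p y" for x y
    using \<epsilon> by (auto simp: p_def group_automorphism_simps[OF group_automorphism_funpow[OF \<alpha>]]
        \<alpha>_simps group_automorphism_simps[OF group_automorphism_funpow[OF \<beta>]])
  have "\<alpha> s = p c" using \<epsilon> by (auto simp: s p_def \<alpha>_simps)
  obtain k where k: "\<beta> k = p h"
    using group_automorphism_surj[OF \<beta>, of "p h"] by metis
  have "p h \<in> \<Sigma>"
    using \<epsilon> h unfolding p_def by (auto simp only: id_apply uminus_\<Sigma>_iff pow_\<Sigma>)
  then have k_\<Sigma>: "k \<in> \<Sigma>" using k \<beta>_\<Sigma> by metis
  have last: "partial_sum \<alpha> \<beta> (gs @ [k]) (Suc (length gs)) = p (c + h)"
    using partial_sum_Suc[OF len, of "gs @ [k]"] partial_sum_append[of "length gs" gs \<alpha> \<beta> "[k]"] len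
      \<open>\<alpha> s = p c\<close> k p_add by (simp add: s_def)
  have "p (c + h) \<in> pm_orbit \<alpha> \<beta> (c + h)"
    using \<epsilon> unfolding pm_orbit_iff p_def by (metis id_apply)
  moreover have "partial_sum \<alpha> \<beta> (gs @ [k]) l \<in> \<Sigma>" if "2 \<le> l" "l \<le> length gs" for l
  proof -
    have "s \<in> \<Sigma>" using pm_orbit_\<Sigma> \<open>s \<in> pm_orbit \<alpha> \<beta> c\<close> c by blast
    then show ?thesis
      using that conn by (cases "l = length gs") (auto simp: partial_sum_append is_connection_iff s_def)
  qed
  ultimately have "is_connection \<alpha> \<beta> \<Sigma> g (c + h) (gs @ [k])"
    using conn k_\<Sigma> last by (auto simp: is_connection_iff nth_append)
  then show thesis by (rule that)
qed

text \<open>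
  The end condition of a connection depends on \<open>c\<close> only through \<open>pm_orbit \<alpha> \<beta> c\<close>. This set is the
  same for \<open>- c\<close> and does not become smaller when \<open>\<alpha> c\<close> or \<open>\<beta> c\<close> is replaced by \<open>c\<close>, which gives
  three of the stability properties; the other two come from transporting and from extending a
  connection.
\<close>

lemma saturated_class:
  assumes "C \<in> \<Sigma> // connected \<alpha> \<beta> \<Sigma>"
  shows "saturated \<alpha> \<beta> \<Sigma> C"
proof -
  obtain g where C: "C = connected \<alpha> \<beta> \<Sigma> `` {g}" and g: "g \<in> \<Sigma>"
    using assms by (rule quotientE)
  have C_iff: "c \<in> C \<longleftrightarrow> c \<in> \<Sigma> \<and> (\<exists>gs. is_connection \<alpha> \<beta> \<Sigma> g c gs)" for c
    using g by (auto simp: C connected_def)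
  have shrink: "c \<in> C" if "\<gamma> c \<in> C" "pm_orbit \<alpha> \<beta> (\<gamma> c) \<subseteq> pm_orbit \<alpha> \<beta> c" "\<gamma> c \<in> \<Sigma> \<longleftrightarrow> c \<in> \<Sigma>" for \<gamma> c
    using that unfolding C_iff is_connection_iff by blast
  show ?thesis
    unfolding saturated_def
  proof (intro conjI allI ballI impI)
    show "C \<subseteq> \<Sigma>" using C_iff by auto
    show "\<alpha> c \<in> C \<longleftrightarrow> c \<in> C" for c
      using shrink[of \<alpha> c] pm_orbit_image_subset \<alpha>_\<Sigma> is_connection_map[of g c _ \<alpha>]
      unfolding C_iff by metis
    show "\<beta> c \<in> C \<longleftrightarrow> c \<in> C" for c
      using shrink[of \<beta> c] pm_orbit_image_subset \<beta>_\<Sigma> is_connection_map[of g c _ \<beta>]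
      unfolding C_iff by metis
    show "- c \<in> C \<longleftrightarrow> c \<in> C" for c
      unfolding C_iff is_connection_iff pm_orbit_uminus uminus_\<Sigma>_iff ..
    show "c + h \<in> C" if "c \<in> C" "h \<in> \<Sigma>" "c + h \<in> \<Sigma>" for c h
      using that is_connection_snoc unfolding C_iff by metis
  qed
qed

end

section \<open>Homogeneous components under automorphisms\<close>

text \<open>
  If \<open>y = f x\<close> has degree \<open>\<gamma> g\<close>, then \<open>f\<close> maps the components of \<open>x\<close> into pairwise different
  degrees, so all of them except the one of degree \<open>g\<close> are mapped to zero. By injectivity they are
  zero, that is, \<open>x\<close> has degree \<open>g\<close>.
\<close>

lemma image_component_eq:
  assumes f: "mat_alg_automorphism I f" and \<gamma>: "group_automorphism \<gamma>"
    and M: "\<forall>g. submodule (M g)" and dir: "is_direct_sum (mats I) UNIV M"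
    and sub: "\<forall>g. f ` M g \<subseteq> M (\<gamma> g)"
  shows "f ` M g = M (\<gamma> g)"
proof
  show "f ` M g \<subseteq> M (\<gamma> g)" using sub by blast
  show "M (\<gamma> g) \<subseteq> f ` M g"
  proof
    fix y assume y: "y \<in> M (\<gamma> g)"
    have M_mats: "M h \<subseteq> mats I" for h
      using dir family_sum_superset[of h UNIV M] by (auto simp: is_direct_sum_def)
    obtain x where x: "x \<in> mats I" "y = f x"
      using f y M_mats unfolding mat_alg_automorphism_def bij_betw_def by blast
    obtain F m where F: "finite F" "\<And>h. h \<in> F \<Longrightarrow> m h \<in> M h" "x = sum m F"
      using dir x(1) unfolding is_direct_sum_def by (metis family_sumE)
    have inj: "inj \<gamma>" using \<gamma> by (simp add: group_automorphism_def bij_def)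
    \<comment> \<open>The images of the components of \<open>x\<close>, indexed by their degrees \<open>\<gamma> h\<close>.\<close>
    define n where "n h = f (m (inv \<gamma> h))" for h
    have n: "n (\<gamma> h) = f (m h)" for h using inj by (simp add: n_def)
    have "y = (\<Sum>h\<in>F. n (\<gamma> h))"
      unfolding x(2) F(3) n
      by (rule mat_linear_on_sum[OF mat_alg_automorphism_linear[OF f]]) (use F M_mats in auto)
    also have "\<dots> = sum n (\<gamma> ` F)"
      using inj by (simp add: sum.reindex inj_on_def inj_def)
    finally have y_sum: "y = sum n (\<gamma> ` F)" .
    have "m h = 0" if h: "h \<in> F" "h \<noteq> g" for h
    proof -
      have "n (\<gamma> h) = 0"
        by (rule direct_sum_component[OF dir, of "\<gamma> ` F" n "\<gamma> g"])
           (use M F sub y y_sum h inj in \<open>auto simp: n inj_def image_subset_iff\<close>)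
      then show ?thesis
        using automorphism_eq_0_iff[OF f] F(2) M_mats h by (metis n subsetD)
    qed
    then have "x = (\<Sum>h\<in>F. if h = g then m h else 0)"
      unfolding F(3) by (intro sum.cong) auto
    then have "x = (if g \<in> F then m g else 0)" using F(1) by simp
    then have "x \<in> M g" using F(2) M submodule_zero by (metis (full_types))
    then show "y \<in> f ` M g" using x(2) by blast
  qed
qed

section \<open>The ideals of the classes\<close>

text \<open>
  The maps \<open>\<psi>\<close> and \<open>\<phi>\<close> are assumed here to map homogeneous components onto homogeneous
  components; for automorphisms the corresponding inclusions suffice by \<open>image_component_eq\<close>.
\<close>

locale twisted_graded_matrices =
  fixes I :: "'i set"
    and \<psi> \<phi> :: "('i, 'r::comm_ring) mat \<Rightarrow> ('i, 'r) mat"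
    and \<alpha> \<beta> :: "'g::ab_group_add \<Rightarrow> 'g"
    and M :: "'g \<Rightarrow> ('i, 'r) mat set"
  assumes \<psi>: "mat_alg_automorphism I \<psi>" and \<phi>: "mat_alg_automorphism I \<phi>"
    and \<alpha>: "group_automorphism \<alpha>" and \<beta>: "group_automorphism \<beta>"
    and commute: "\<alpha> \<circ> \<beta> = \<beta> \<circ> \<alpha>"
    and submodule_M: "submodule (M g)"
    and direct: "is_direct_sum (mats I) UNIV M"
    and \<psi>_M: "\<psi> ` M g = M (\<alpha> g)"
    and \<phi>_M: "\<phi> ` M g = M (\<beta> g)"
    and star_M: "star_set \<psi> \<phi> (M g) (M g') \<subseteq> M (\<alpha> g + \<beta> g')"
    and symmetric: "g \<in> supp M \<Longrightarrow> - g \<in> supp M"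
begin

lemma mats_eq: "mats I = family_sum UNIV M"
  using direct by (simp add: is_direct_sum_def)

lemma M_mats: "M g \<subseteq> mats I"
  unfolding mats_eq by (rule family_sum_superset) simp

lemma mats_minimal:
  assumes "submodule S" "\<And>g. M g \<subseteq> S"
  shows "mats I \<subseteq> S"
  unfolding mats_eq by (rule family_sum_minimal) (use assms in auto)

lemma component_trivial_iff:
  assumes f: "mat_alg_automorphism I f"
  shows "f ` M g = {0} \<longleftrightarrow> M g = {0}"
proof -
  have iff: "S = {0} \<longleftrightarrow> (\<forall>x\<in>S. x = 0)" if "0 \<in> S" for S :: "('i, 'r) mat set"
    using that by blast
  have "0 \<in> M g" by (rule submodule_zero[OF submodule_M])
  moreover from this have "0 \<in> f ` M g"
    using automorphism_eq_0_iff[OF f] M_mats by (metis image_eqI subsetD)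
  ultimately show ?thesis
    using automorphism_eq_0_iff[OF f] M_mats[of g] by (simp add: iff subset_eq)
qed

lemma supp_image_iff: "\<alpha> g \<in> supp M \<longleftrightarrow> g \<in> supp M" "\<beta> g \<in> supp M \<longleftrightarrow> g \<in> supp M"
  using component_trivial_iff[OF \<psi>, of g] component_trivial_iff[OF \<phi>, of g]
  by (simp_all add: supp_def \<psi>_M \<phi>_M group_automorphism_simps(5)[OF \<alpha>]
      group_automorphism_simps(5)[OF \<beta>])

sublocale commuting_automorphisms \<alpha> \<beta> "supp M"
  by unfold_locales (fact \<alpha> \<beta> commute supp_image_iff symmetric)+

text \<open>
  Homogeneous \<open>x\<close> and \<open>y\<close> are of the form \<open>\<psi> x'\<close> and \<open>\<phi> y'\<close> with homogeneous \<open>x'\<close> and \<open>y'\<close>, so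
  that their ordinary product is a twisted one.
\<close>

lemma mult_M:
  assumes "x \<in> M g" "y \<in> M h"
  shows "mat_mult x y \<in> M (g + h)"
proof -
  obtain g' h' where g': "g = \<alpha> g'" and h': "h = \<beta> h'"
    using group_automorphism_surj[OF \<alpha>] group_automorphism_surj[OF \<beta>] by blast
  have "x \<in> \<psi> ` M g'" "y \<in> \<phi> ` M h'"
    using assms unfolding \<psi>_M \<phi>_M g' h' by simp_all
  then obtain x' y' where "x = \<psi> x'" "x' \<in> M g'" "y = \<phi> y'" "y' \<in> M h'"
    by blast
  then have "mat_mult x y \<in> {star \<psi> \<phi> x y | x y. x \<in> M g' \<and> y \<in> M h'}"
    by (auto simp: star_def)
  then show ?thesis
    using star_M[of g' h'] lin_span_superset unfolding g' h' star_set_def by (meson subsetD)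
qed

definition loop_products :: "'g set \<Rightarrow> ('i, 'r) mat set" where
  "loop_products C = (\<Union>c\<in>C. {mat_mult x y | x y. x \<in> M c \<and> y \<in> M (- c)})"

context
  fixes C :: "'g set"
  assumes saturated: "saturated \<alpha> \<beta> (supp M) C"
begin

lemma C_supp: "c \<in> C \<Longrightarrow> c \<in> supp M"
  and C_\<alpha>: "\<alpha> c \<in> C \<longleftrightarrow> c \<in> C"
  and C_\<beta>: "\<beta> c \<in> C \<longleftrightarrow> c \<in> C"
  and C_uminus: "- c \<in> C \<longleftrightarrow> c \<in> C"
  and C_add: "c \<in> C \<Longrightarrow> h \<in> supp M \<Longrightarrow> c + h \<in> supp M \<Longrightarrow> c + h \<in> C"
  using saturated unfolding saturated_def by (auto simp only: subset_eq)

text \<open>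
  As \<open>\<psi>\<close> and \<open>\<phi>\<close> map components onto components, the twisted product of \<open>M (\<beta> c)\<close> and
  \<open>M (- \<alpha> c)\<close> is the ordinary product of \<open>M (\<alpha> (\<beta> c))\<close> and \<open>M (- \<alpha> (\<beta> c))\<close>, and
  \<open>\<alpha> (\<beta> c)\<close> runs through \<open>C\<close> together with \<open>c\<close>.
\<close>

lemma ideal_zero_eq: "ideal_zero \<psi> \<phi> \<alpha> \<beta> M C = lin_span (loop_products C)"
proof -
  have star: "{star \<psi> \<phi> x y | x y. x \<in> M (\<beta> c) \<and> y \<in> M (- \<alpha> c)} =
      {mat_mult x y | x y. x \<in> M (\<alpha> (\<beta> c)) \<and> y \<in> M (- \<alpha> (\<beta> c))}" for c
  proof -
    have "M (\<alpha> (\<beta> c)) = \<psi> ` M (\<beta> c)" "M (- \<alpha> (\<beta> c)) = \<phi> ` M (- \<alpha> c)"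
      by (simp_all only: \<psi>_M \<phi>_M \<beta>_simps \<alpha>\<beta>)
    moreover have "{mat_mult (\<psi> x) (\<phi> y) | x y. x \<in> A \<and> y \<in> B} =
        {mat_mult x y | x y. x \<in> \<psi> ` A \<and> y \<in> \<phi> ` B}" for A B
      by blast
    ultimately show ?thesis unfolding star_def by (simp only:)
  qed
  have C_image: "(\<lambda>c. \<alpha> (\<beta> c)) ` C = C"
  proof
    show "C \<subseteq> (\<lambda>c. \<alpha> (\<beta> c)) ` C"
    proof
      fix c assume "c \<in> C"
      moreover obtain d where "c = \<alpha> (\<beta> d)"
        using group_automorphism_surj[OF \<alpha>] group_automorphism_surj[OF \<beta>] by metis
      ultimately show "c \<in> (\<lambda>c. \<alpha> (\<beta> c)) ` C" by (auto simp: C_\<alpha> C_\<beta>)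
    qed
  qed (auto simp: C_\<alpha> C_\<beta>)
  have "loop_products ((\<lambda>c. \<alpha> (\<beta> c)) ` C) =
      (\<Union>c\<in>C. {mat_mult x y | x y. x \<in> M (\<alpha> (\<beta> c)) \<and> y \<in> M (- \<alpha> (\<beta> c))})"
    unfolding loop_products_def by (rule UN_simps(10))
  then show ?thesis
    unfolding ideal_zero_def star_set_def star lin_span_UN_lin_span C_image by (simp only:)
qed

abbreviation "J \<equiv> ideal_class \<psi> \<phi> \<alpha> \<beta> M C"

lemma submodule_ideal_zero: "submodule (ideal_zero \<psi> \<phi> \<alpha> \<beta> M C)"
  by (simp add: ideal_zero_def submodule_lin_span)

lemma submodule_ideal_V: "submodule (ideal_V M C)"
  unfolding ideal_V_def by (rule submodule_family_sum) (rule submodule_M)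

lemma submodule_J: "submodule J"
  unfolding ideal_class_def by (intro submodule_plus submodule_ideal_zero submodule_ideal_V)

lemma M_subset_J: "c \<in> C \<Longrightarrow> M c \<subseteq> J"
  using plus_superset(2)[OF submodule_ideal_zero submodule_ideal_V] family_sum_superset[of c C M]
  unfolding ideal_class_def ideal_V_def by blast

lemma ideal_zero_subset_J: "ideal_zero \<psi> \<phi> \<alpha> \<beta> M C \<subseteq> J"
  unfolding ideal_class_def by (rule plus_superset(1)[OF submodule_ideal_zero submodule_ideal_V])

lemma loop_product_in_J: "c \<in> C \<Longrightarrow> x \<in> M c \<Longrightarrow> y \<in> M (- c) \<Longrightarrow> mat_mult x y \<in> J"
proof -
  assume "c \<in> C" "x \<in> M c" "y \<in> M (- c)"
  then have "mat_mult x y \<in> loop_products C" unfolding loop_products_def by blast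
  then show ?thesis
    using lin_span_superset ideal_zero_subset_J unfolding ideal_zero_eq by (meson subsetD)
qed

text \<open>
  An induction principle: a property of the elements of \<open>J\<close> that defines a submodule need only be
  verified on these two kinds of generators.
\<close>

lemma J_minimal:
  assumes "submodule S" "\<And>c. c \<in> C \<Longrightarrow> M c \<subseteq> S"
    and "\<And>c x y. c \<in> C \<Longrightarrow> x \<in> M c \<Longrightarrow> y \<in> M (- c) \<Longrightarrow> mat_mult x y \<in> S"
  shows "J \<subseteq> S"
  unfolding ideal_class_def ideal_zero_eq ideal_V_def
  by (intro plus_minimal lin_span_minimal family_sum_minimal)
     (use assms in \<open>auto simp: loop_products_def\<close>)

lemma J_mats: "J \<subseteq> mats I"
proof (rule J_minimal[OF submodule_mats M_mats])
  show "mat_mult x y \<in> mats I" if "x \<in> M c" "y \<in> M (- c)" for c x y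
    using that M_mats mat_mult_in_mats by blast
qed

lemma ideal_zero_subset_M: "ideal_zero \<psi> \<phi> \<alpha> \<beta> M C \<subseteq> M 0"
proof -
  have "mat_mult x y \<in> M 0" if "x \<in> M c" "y \<in> M (- c)" for x y c
    using mult_M[OF that] by simp
  then show ?thesis
    unfolding ideal_zero_eq
    by (intro lin_span_minimal submodule_M) (auto simp: loop_products_def)
qed

text \<open>
  Both inclusions follow from \<open>J_minimal\<close>, applied to the preimage and to the image of \<open>J\<close>: the
  map permutes the components with degrees in \<open>C\<close>, and with them the products of components with
  opposite degrees.
\<close>

lemma J_image:
  assumes f: "mat_alg_automorphism I f" and \<gamma>: "group_automorphism \<gamma>"
    and f_M: "\<And>g. f ` M g = M (\<gamma> g)" and C_\<gamma>: "\<And>c. \<gamma> c \<in> C \<longleftrightarrow> c \<in> C"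
  shows "f ` J = J"
proof
  note lin = mat_alg_automorphism_linear[OF f]
  have mult: "f (mat_mult x y) = mat_mult (f x) (f y)" if "x \<in> M g" "y \<in> M h" for x y g h
    using f that M_mats unfolding mat_alg_automorphism_def by blast
  have "J \<subseteq> {x \<in> mats I. f x \<in> J}"
  proof (rule J_minimal[OF submodule_vimage[OF lin submodule_J]])
    show "M c \<subseteq> {x \<in> mats I. f x \<in> J}" if "c \<in> C" for c
      using that M_mats f_M[of c] M_subset_J[of "\<gamma> c"] C_\<gamma> by blast
    fix c x y assume c: "c \<in> C" "x \<in> M c" "y \<in> M (- c)"
    then have "f x \<in> M (\<gamma> c)" "f y \<in> M (- \<gamma> c)"
      using f_M[of c] f_M[of "- c"] by (auto simp: group_automorphism_simps[OF \<gamma>])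
    then have "f (mat_mult x y) \<in> J"
      using loop_product_in_J[of "\<gamma> c"] C_\<gamma> c mult by metis
    then show "mat_mult x y \<in> {x \<in> mats I. f x \<in> J}"
      using c M_mats mat_mult_in_mats by blast
  qed
  then show "f ` J \<subseteq> J" by blast
  show "J \<subseteq> f ` J"
  proof (rule J_minimal[OF submodule_image[OF lin submodule_J J_mats]])
    have preimage: "\<exists>d. \<gamma> d = c \<and> d \<in> C" if "c \<in> C" for c
      using that group_automorphism_surj[OF \<gamma>, of c] C_\<gamma> by blast
    show "M c \<subseteq> f ` J" if "c \<in> C" for c
      using preimage[OF that] f_M M_subset_J by (metis image_mono)
    fix c x y assume c: "c \<in> C" "x \<in> M c" "y \<in> M (- c)"
    obtain d where d: "\<gamma> d = c" "d \<in> C" using preimage[OF c(1)] by blast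
    have "x \<in> f ` M d" "y \<in> f ` M (- d)"
      using c by (simp_all add: f_M group_automorphism_simps[OF \<gamma>] d(1))
    then obtain x' y' where "x = f x'" "x' \<in> M d" "y = f y'" "y' \<in> M (- d)"
      by blast
    then show "mat_mult x y \<in> f ` J"
      using mult loop_product_in_J d(2) by (metis imageI)
  qed
qed

lemma eq_0_or_in_supp: "x \<in> M g \<Longrightarrow> x = 0 \<or> g = 0 \<or> g \<in> supp M"
  by (auto simp: supp_def)

lemma mult_component_in_J:
  assumes "c \<in> C" "x \<in> M c" "y \<in> M h"
  shows "mat_mult x y \<in> J \<and> mat_mult y x \<in> J"
proof -
  have xy: "mat_mult x y \<in> M (c + h)" and yx: "mat_mult y x \<in> M (c + h)"
    using mult_M assms by (metis add.commute)+
  consider "c + h = 0" | "h = 0" | "y = 0" | "c + h \<noteq> 0" "h \<in> supp M"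
    using eq_0_or_in_supp[OF assms(3)] by auto
  then show ?thesis
  proof cases
    case 1
    then have h: "h = - c" by (simp add: eq_neg_iff_add_eq_0 add.commute)
    then show ?thesis
      using assms loop_product_in_J[of c x y] loop_product_in_J[of "- c" y x] C_uminus by simp
  next
    case 2
    then show ?thesis using xy yx M_subset_J[OF assms(1)] by auto
  next
    case 3
    then show ?thesis using submodule_zero[OF submodule_J] by simp
  next
    case 4
    have "mat_mult x y = 0 \<and> mat_mult y x = 0 \<or> c + h \<in> C"
      using 4 eq_0_or_in_supp[OF xy] eq_0_or_in_supp[OF yx] C_add[OF assms(1)] by blast
    then show ?thesis
      using xy yx M_subset_J submodule_zero[OF submodule_J] by (metis subsetD)
  qed
qed

text \<open>
  If \<open>c + h\<close> were in the support, it would be in \<open>C\<close>, and adding \<open>- c\<close> would put \<open>h\<close> into \<open>C\<close>.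
\<close>

lemma orthogonal_outside:
  assumes "c \<in> C" "x \<in> M c" "h \<notin> C" "h \<noteq> 0" "y \<in> M h"
  shows "mat_mult x y = 0" "mat_mult y x = 0"
proof -
  have "y = 0 \<or> (M (c + h) \<subseteq> {0})"
  proof (rule disjCI)
    assume "\<not> M (c + h) \<subseteq> {0}"
    show "y = 0"
    proof (rule ccontr)
      assume "y \<noteq> 0"
      then have h: "h \<in> supp M" using eq_0_or_in_supp assms by blast
      have "c + h \<noteq> 0" using assms(1,3) C_uminus by (metis add_eq_0_iff)
      then have "c + h \<in> supp M"
        using \<open>\<not> M (c + h) \<subseteq> {0}\<close> by (auto simp: supp_def)
      then have "c + h \<in> C" using C_add assms(1) h by blast
      then have "(c + h) + (- c) \<in> C"
        using C_add[of "c + h" "- c"] C_supp C_uminus assms(1) h by auto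
      then show False using assms(3) by simp
    qed
  qed
  then show "mat_mult x y = 0" "mat_mult y x = 0"
    using mult_M[OF assms(2,5)] mult_M[OF assms(5,2)] by (auto simp: add.commute)
qed

text \<open>
  Associativity allows to multiply \<open>z\<close> first with the adjacent factor. In degree zero this does not
  change the degrees of the factors; for a non-zero degree outside \<open>C\<close> it gives zero. For \<open>h\<close> in
  \<open>C\<close> the roles are exchanged: \<open>z\<close> is a generator and \<open>x y\<close> has degree zero.
\<close>

lemma mult_loop_product_in_J:
  assumes c: "c \<in> C" "x \<in> M c" "y \<in> M (- c)" and z: "z \<in> M h"
  shows "mat_mult (mat_mult x y) z \<in> J \<and> mat_mult z (mat_mult x y) \<in> J"
proof -
  have mats: "x \<in> mats I" "y \<in> mats I" "z \<in> mats I" using assms M_mats by blast+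
  have assoc: "mat_mult (mat_mult x y) z = mat_mult x (mat_mult y z)"
    "mat_mult z (mat_mult x y) = mat_mult (mat_mult z x) y"
    using mats mat_mult_assoc by metis+
  have c': "- c \<in> C" using c C_uminus by simp
  have xy: "mat_mult x y \<in> M 0" using mult_M[OF c(2,3)] by simp
  consider "h = 0" | "h \<in> C" | "h \<notin> C" "h \<noteq> 0" by blast
  then show ?thesis
  proof cases
    case 1
    then have "mat_mult y z \<in> M (- c)" "mat_mult z x \<in> M c"
      using mult_M[OF c(3) z] mult_M[OF z c(2)] by auto
    then show ?thesis unfolding assoc using loop_product_in_J c by auto
  next
    case 2
    then show ?thesis using mult_component_in_J[OF 2 z xy] by simp
  next
    case 3
    then show ?thesis
      unfolding assoc using orthogonal_outside[OF c'(1) c(3) 3 z] orthogonal_outside[OF c(1,2) 3 z]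
        submodule_zero[OF submodule_J] by simp
  qed
qed

lemma J_mult:
  assumes x: "x \<in> J" and y: "y \<in> mats I"
  shows "mat_mult x y \<in> J" "mat_mult y x \<in> J"
proof -
  have component: "mat_mult x z \<in> J \<and> mat_mult z x \<in> J" if "z \<in> M h" for z h
  proof -
    have z: "z \<in> mats I" using that M_mats by blast
    let ?S = "{x \<in> mats I. mat_mult x z \<in> J} \<inter> {x \<in> mats I. mat_mult z x \<in> J}"
    have "submodule ?S"
      using submodule_vimage[OF mat_linear_on_mult_right[OF z] submodule_J]
        submodule_vimage[OF mat_linear_on_mult_left[OF z] submodule_J]
      unfolding submodule_def by blast
    then have "J \<subseteq> ?S"
    proof (rule J_minimal)
      show "M c \<subseteq> ?S" if "c \<in> C" for c
        using that \<open>z \<in> M h\<close> mult_component_in_J M_mats by blast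
      show "mat_mult x y \<in> ?S" if "c \<in> C" "x \<in> M c" "y \<in> M (- c)" for c x y
        using that \<open>z \<in> M h\<close> mult_loop_product_in_J[OF that] M_mats mat_mult_in_mats by blast
    qed
    then show ?thesis using x by blast
  qed
  have x_mats: "x \<in> mats I" using x J_mats by blast
  let ?S = "{y \<in> mats I. mat_mult x y \<in> J} \<inter> {y \<in> mats I. mat_mult y x \<in> J}"
  have "submodule ?S"
    using submodule_vimage[OF mat_linear_on_mult_right[OF x_mats] submodule_J]
      submodule_vimage[OF mat_linear_on_mult_left[OF x_mats] submodule_J]
    unfolding submodule_def by blast
  then have "mats I \<subseteq> ?S"
    by (rule mats_minimal) (use component M_mats in blast)
  then show "mat_mult x y \<in> J" "mat_mult y x \<in> J" using y by blast+
qed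

text \<open>
  The first summand has degree zero, and zero is not a degree in the support.
\<close>

lemma ideal_zero_Int_ideal_V: "ideal_zero \<psi> \<phi> \<alpha> \<beta> M C \<inter> ideal_V M C = {0}"
proof
  show "{0} \<subseteq> ideal_zero \<psi> \<phi> \<alpha> \<beta> M C \<inter> ideal_V M C"
    using submodule_zero submodule_ideal_zero submodule_ideal_V by auto
  show "ideal_zero \<psi> \<phi> \<alpha> \<beta> M C \<inter> ideal_V M C \<subseteq> {0}"
  proof
    fix a assume a: "a \<in> ideal_zero \<psi> \<phi> \<alpha> \<beta> M C \<inter> ideal_V M C"
    then obtain F m where F: "finite F" "F \<subseteq> C" "\<And>y. y \<in> F \<Longrightarrow> m y \<in> M y" "a = sum m F"
      unfolding ideal_V_def by (metis family_sumE IntD2)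
    have "m c = 0" if "c \<in> F" for c
    proof (rule direct_sum_component[OF direct submodule_M])
      show "c \<noteq> 0" using that F(2) C_supp by (auto simp: supp_def)
      show "sum m F \<in> M 0" using a ideal_zero_subset_M F(4) by blast
    qed (use F that in auto)
    then show "a \<in> {0}" using F(4) by simp
  qed
qed

text \<open>
  The ideal is generated by homogeneous elements, hence is the sum of its homogeneous parts;
  independence is inherited from the whole algebra.
\<close>

lemma is_direct_sum_J: "is_direct_sum J UNIV (\<lambda>g. J \<inter> M g)"
proof -
  have sub: "submodule (family_sum UNIV (\<lambda>g. J \<inter> M g))"
    by (rule submodule_family_sum) (use submodule_J submodule_M in \<open>auto simp: submodule_def\<close>)
  have comp: "J \<inter> M g \<subseteq> family_sum UNIV (\<lambda>g. J \<inter> M g)" for g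
    using family_sum_superset[of g UNIV "\<lambda>g. J \<inter> M g"] by simp
  have "J \<subseteq> family_sum UNIV (\<lambda>g. J \<inter> M g)"
  proof (rule J_minimal[OF sub])
    show "M c \<subseteq> family_sum UNIV (\<lambda>g. J \<inter> M g)" if "c \<in> C" for c
      using comp[of c] M_subset_J[OF that] by blast
    show "mat_mult x y \<in> family_sum UNIV (\<lambda>g. J \<inter> M g)" if "c \<in> C" "x \<in> M c" "y \<in> M (- c)" for c x y
      using comp[of 0] loop_product_in_J[OF that] mult_M[OF that(2,3)] by auto
  qed
  moreover have "family_sum UNIV (\<lambda>g. J \<inter> M g) \<subseteq> J"
    by (rule family_sum_minimal[OF submodule_J]) auto
  ultimately show ?thesis
    using direct unfolding is_direct_sum_def by blast
qed

lemma graded_ideal_J: "graded_ideal I \<psi> \<phi> M J"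
proof -
  have \<psi>_J: "\<psi> ` J = J" by (rule J_image[OF \<psi> \<alpha> \<psi>_M C_\<alpha>])
  have \<phi>_J: "\<phi> ` J = J" by (rule J_image[OF \<phi> \<beta> \<phi>_M C_\<beta>])
  have "\<psi> y \<in> mats I" "\<phi> y \<in> mats I" if "y \<in> mats I" for y
    using that \<psi> \<phi> mat_alg_automorphism_linear unfolding mat_linear_on_def by blast+
  moreover have "\<psi> x \<in> J" "\<phi> x \<in> J" if "x \<in> J" for x
    using that \<psi>_J \<phi>_J by blast+
  ultimately have "star \<psi> \<phi> x y \<in> J" "star \<psi> \<phi> y x \<in> J" if "x \<in> J" "y \<in> mats I" for x y
    unfolding star_def using that J_mult by simp_all
  then have "star_set \<psi> \<phi> J (mats I) + star_set \<psi> \<phi> (mats I) J \<subseteq> J"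
    unfolding star_set_def by (intro plus_minimal lin_span_minimal submodule_J) auto
  then show ?thesis
    unfolding graded_ideal_def
    using submodule_J J_mats \<psi>_J \<phi>_J is_direct_sum_J by blast
qed

end

lemma mats_eq_M_0_plus:
  "mats I = M 0 + family_sum (supp M // connected \<alpha> \<beta> (supp M)) (ideal_class \<psi> \<phi> \<alpha> \<beta> M)"
    (is "_ = M 0 + ?T")
proof
  have T: "submodule ?T"
    by (rule submodule_family_sum) (rule submodule_J[OF saturated_class])
  show "M 0 + ?T \<subseteq> mats I"
    by (intro plus_minimal submodule_mats M_mats family_sum_minimal J_mats[OF saturated_class])
  show "mats I \<subseteq> M 0 + ?T"
  proof (rule mats_minimal[OF submodule_plus[OF submodule_M T]])
    fix g
    consider "g = 0" | "M g = {0}" | "g \<in> supp M" by (auto simp: supp_def)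
    then show "M g \<subseteq> M 0 + ?T"
    proof cases
      case 1
      then show ?thesis using plus_superset(1)[OF submodule_M T] by simp
    next
      case 2
      then show ?thesis using submodule_zero[OF submodule_plus[OF submodule_M T]] by simp
    next
      case 3
      let ?C = "connected \<alpha> \<beta> (supp M) `` {g}"
      have C: "?C \<in> supp M // connected \<alpha> \<beta> (supp M)" using 3 by (rule quotientI)
      have "M g \<subseteq> ideal_class \<psi> \<phi> \<alpha> \<beta> M ?C"
        using M_subset_J[OF saturated_class[OF C]] connected_refl[OF 3] by blast
      also have "\<dots> \<subseteq> ?T" using family_sum_superset[OF C] .
      also have "\<dots> \<subseteq> M 0 + ?T" by (rule plus_superset(2)[OF submodule_M T])
      finally show ?thesis .
    qed
  qed
qed

end

theorem theorem4p5:
  fixes I :: "'i set"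
    and \<psi> \<phi> :: "('i, 'r::comm_ring) mat \<Rightarrow> ('i, 'r) mat"
    and \<alpha> \<beta> :: "'g::ab_group_add \<Rightarrow> 'g"
    and M :: "'g \<Rightarrow> ('i, 'r) mat set"
  assumes "mat_alg_automorphism I \<psi>" and "mat_alg_automorphism I \<phi>"
    and "\<forall>A\<in>mats I. \<psi> (\<phi> A) = \<phi> (\<psi> A)"
    and "group_automorphism \<alpha>" and "group_automorphism \<beta>"
    and "\<alpha> \<circ> \<beta> = \<beta> \<circ> \<alpha>"
    and "\<forall>g. submodule (M g)"
    and "is_direct_sum (mats I) UNIV M"
    and "\<forall>g. \<psi> ` M g \<subseteq> M (\<alpha> g)"
    and "\<forall>g. \<phi> ` M g \<subseteq> M (\<beta> g)"
    and "\<forall>g g'. star_set \<psi> \<phi> (M g) (M g') \<subseteq> M (\<alpha> g + \<beta> g')"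
    and "\<forall>g\<in>supp M. - g \<in> supp M"
  shows "\<exists>U. submodule U \<and> U \<subseteq> M 0 \<and>
      mats I = U + family_sum (supp M // connected \<alpha> \<beta> (supp M)) (ideal_class \<psi> \<phi> \<alpha> \<beta> M) \<and>
      (\<forall>C \<in> supp M // connected \<alpha> \<beta> (supp M).
         ideal_class \<psi> \<phi> \<alpha> \<beta> M C = ideal_zero \<psi> \<phi> \<alpha> \<beta> M C + ideal_V M C \<and>
         ideal_zero \<psi> \<phi> \<alpha> \<beta> M C \<inter> ideal_V M C = {0} \<and>
         graded_ideal I \<psi> \<phi> M (ideal_class \<psi> \<phi> \<alpha> \<beta> M C))"
proof -
  interpret twisted_graded_matrices I \<psi> \<phi> \<alpha> \<beta> M
  proof
    show "\<psi> ` M g = M (\<alpha> g)" for g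
      by (rule image_component_eq[OF assms(1,4,7,8,9)])
    show "\<phi> ` M g = M (\<beta> g)" for g
      by (rule image_component_eq[OF assms(2,5,7,8,10)])
  qed (use assms in \<open>simp_all only: simp_thms\<close>)
  \<comment> \<open>The homogeneous component of degree zero is the largest possible choice of \<open>U\<close>.\<close>
  show ?thesis
  proof (intro exI conjI ballI)
    show "submodule (M 0)" by (rule submodule_M)
    show "M 0 \<subseteq> M 0" ..
    show "mats I = M 0 +
        family_sum (supp M // connected \<alpha> \<beta> (supp M)) (ideal_class \<psi> \<phi> \<alpha> \<beta> M)"
      by (rule mats_eq_M_0_plus)
    fix C assume "C \<in> supp M // connected \<alpha> \<beta> (supp M)"
    then have C: "saturated \<alpha> \<beta> (supp M) C" by (rule saturated_class)
    show "ideal_class \<psi> \<phi> \<alpha> \<beta> M C = ideal_zero \<psi> \<phi> \<alpha> \<beta> M C + ideal_V M C"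
      by (rule ideal_class_def)
    show "ideal_zero \<psi> \<phi> \<alpha> \<beta> M C \<inter> ideal_V M C = {0}"
      by (rule ideal_zero_Int_ideal_V[OF C])
    show "graded_ideal I \<psi> \<phi> M (ideal_class \<psi> \<phi> \<alpha> \<beta> M C)"
      by (rule graded_ideal_J[OF C])
  qed
qed

end
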